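(* For every integer $k\ge 5$, the symmetric numerical semigroup $S_k=\{0,k,k+1,k+2,\dots\}\setminus\{2k-1\}$ is not cyclotomic; equivalently, its semigroup polynomial $1-x+x^k-x^{2k-1}+x^{2k}$ is not a Kronecker polynomial.
   Context: A numerical semigroup $S$ is a submonoid of $(\mathbb{N},+)$ with finite complement $\mathcal{G}=\mathbb{N}\setminus S$; its semigroup polynomial is $\mathrm{P}_S(x)=1+(x-1)\sum_{g\in\mathcal{G}}x^g$. A Kronecker polynomial is a monic polynomial in $\mathbb{Z}[x]$ all of whose complex roots lie in the closed unit disc. $S$ is cyclotomic if $\mathrm{P}_S$ is a Kronecker polynomial. *)

theory Defs
  imports Complex_Main "HOL-Computational_Algebra.Polynomial"
begin

definition numerical_semigroup :: "nat set \<Rightarrow> bool" where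
  "numerical_semigroup S \<longleftrightarrow> 0 \<in> S \<and> (\<forall>a\<in>S. \<forall>b\<in>S. a + b \<in> S) \<and> finite (- S)"

definition gaps :: "nat set \<Rightarrow> nat set" where
  "gaps S = - S"

(* The largest integer outside S, which is -1 when there are no gaps. *)
definition frobenius :: "nat set \<Rightarrow> int" where
  "frobenius S = (if gaps S = {} then -1 else int (Max (gaps S)))"

(* S is regarded as a set of integers: negative integers are not in S. *)
definition symmetric_semigroup :: "nat set \<Rightarrow> bool" where
  "symmetric_semigroup S \<longleftrightarrow>
     numerical_semigroup S \<and>
     (\<forall>z::int. z \<in> int ` S \<longleftrightarrow> frobenius S - z \<notin> int ` S)"

definition semigroup_poly :: "nat set \<Rightarrow> int poly" where
  "semigroup_poly S = 1 + (monom 1 1 - 1) * (\<Sum>g\<in>gaps S. monom 1 g)"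

definition kronecker_poly :: "int poly \<Rightarrow> bool" where
  "kronecker_poly p \<longleftrightarrow>
     lead_coeff p = 1 \<and>
     (\<forall>z::complex. poly (map_poly of_int p) z = 0 \<longrightarrow> cmod z \<le> 1)"

(* Meaningful only for numerical semigroups, where the sum over the gaps is finite. *)
definition cyclotomic_semigroup :: "nat set \<Rightarrow> bool" where
  "cyclotomic_semigroup S \<longleftrightarrow> kronecker_poly (semigroup_poly S)"

definition S_semigroup :: "nat \<Rightarrow> nat set" where
  "S_semigroup k = ({0} \<union> {k..}) - {2 * k - 1}"

end

theory Submission
  imports Defs "HOL-Analysis.Complex_Transcendental"
    "HOL-Computational_Algebra.Fundamental_Theorem_Algebra"
begin

text \<open>
  On the unit circle the semigroup polynomial \<open>P\<close> has modulus
  \<open>\<bar>1 - 4 sin ((2k-1)t/2) sin (t/2)\<bar>\<close> at \<open>cis t\<close>. If \<open>P\<close> is Kronecker then, being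
  self-reciprocal, it has all its roots on the unit circle, so \<open>t \<mapsto> ln \<bar>P (cis t)\<bar>\<close>
  is concave on every arc free of roots. For \<open>k \<ge> 5\<close> the arc \<open>0 < t < 2a\<close> with
  \<open>a = \<pi>/(2k-1)\<close> is free of roots; the modulus is \<open>1\<close> at both ends but less than
  \<open>1\<close> at the midpoint, a contradiction.
\<close>

section \<open>Midpoint inequality on an arc free of roots\<close>

lemma cmod_cis_diff: "cmod (cis s - cis t) = 2 * \<bar>sin ((s - t) / 2)\<bar>"
proof -
  have "(cmod (cis s - cis t))\<^sup>2 = (cos s - cos t)\<^sup>2 + (sin s - sin t)\<^sup>2"
    by (simp add: cmod_power2)
  also have "\<dots> = (sin s ^ 2 + cos s ^ 2) + (sin t ^ 2 + cos t ^ 2) - 2 * cos (s - t)"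
    unfolding cos_diff by (simp add: power2_eq_square algebra_simps)
  also have "\<dots> = (2 * \<bar>sin ((s - t) / 2)\<bar>)\<^sup>2"
    using cos_double_sin[of "(s - t) / 2"] by (simp add: power_mult_distrib diff_divide_distrib)
  finally show ?thesis
    by (rule power2_eq_imp_eq) simp_all
qed

text \<open>The factor \<open>x - z\<close> of a polynomial satisfies midpoint log-concavity on an
  arc avoiding \<open>z\<close>: chord lengths are sines of half angles, and sine is log-concave
  between 0 and pi.\<close>

lemma dist_endpoints_le_dist_midpoint_squared:
  assumes "0 < a" and "cmod z = 1" and off: "\<And>t. 0 < t \<Longrightarrow> t < 2 * a \<Longrightarrow> z \<noteq> cis t"
  shows "cmod (1 - z) * cmod (cis (2 * a) - z) \<le> (cmod (cis a - z))\<^sup>2"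
proof -
  obtain t where t: "0 \<le> t" "t < 2 * pi" "z = cis t"
    using Arg2pi[of z] assms(2) by (auto simp: is_Arg_def cis_conv_exp)
  show ?thesis
  proof (cases "t = 0")
    case True
    thus ?thesis using t by simp
  next
    case False
    hence ta: "2 * a \<le> t"
      using off[of t] t by fastforce
    \<comment> \<open>Half the angles from the two endpoints and the midpoint of the arc to
      \<open>z\<close>, so \<open>w\<close> is the mean of \<open>u\<close> and
      \<open>v\<close>.\<close>
    define u v w where "u = t / 2" and "v = t / 2 - a" and "w = (t - a) / 2"
    have pos: "0 \<le> sin u" "0 \<le> sin v"
      using t ta assms(1) by (auto simp: u_def v_def intro!: sin_ge_zero)
    have "cmod (1 - z) = 2 * sin u"
      using cmod_cis_diff[of 0 t] t pos by (simp add: u_def)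
    moreover have "cmod (cis (2 * a) - z) = 2 * sin v"
    proof -
      have "(2 * a - t) / 2 = - v" by (simp add: v_def field_simps)
      thus ?thesis using cmod_cis_diff[of "2 * a" t] t pos by simp
    qed
    moreover have "(cmod (cis a - z))\<^sup>2 = 4 * (sin w)\<^sup>2"
    proof -
      have "(a - t) / 2 = - w" by (simp add: w_def field_simps)
      thus ?thesis using cmod_cis_diff[of a t] t by (simp add: power_mult_distrib)
    qed
    moreover have "4 * (sin u * sin v) = 2 * cos a - 2 * cos (2 * w)"
    proof -
      have "u - v = a" "u + v = 2 * w" by (simp_all add: u_def v_def w_def field_simps)
      thus ?thesis using sin_times_sin[of u v] by simp
    qed
    moreover have "4 * (sin w)\<^sup>2 = 2 - 2 * cos (2 * w)"
      using cos_double_sin[of w] by simp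
    ultimately show ?thesis
      using cos_le_one[of a] by simp
  qed
qed

text \<open>The inequality for one root is multiplicative, so it passes to the product over all
  roots; the leading coefficient contributes its squared modulus to both sides.\<close>

lemma poly_endpoints_le_midpoint_squared:
  fixes p :: "complex poly"
  assumes "0 < a"
    and unit: "\<And>z. poly p z = 0 \<Longrightarrow> cmod z = 1"
    and off: "\<And>t. 0 < t \<Longrightarrow> t < 2 * a \<Longrightarrow> poly p (cis t) \<noteq> 0"
  shows "cmod (poly p 1) * cmod (poly p (cis (2 * a))) \<le> (cmod (poly p (cis a)))\<^sup>2"
proof -
  have "p \<noteq> 0" using unit[of 0] by auto
  define Q :: "complex multiset \<Rightarrow> complex poly" where "Q A = (\<Prod>x\<in>#A. [:- x, 1:])" for A
  \<comment> \<open>Stated for any multiset of roots, so that induction can add one linear factor at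
    a time.\<close>
  have Q: "cmod (poly (Q A) 1) * cmod (poly (Q A) (cis (2 * a))) \<le> (cmod (poly (Q A) (cis a)))\<^sup>2"
    if "\<forall>z\<in>#A. poly p z = 0" for A
    using that
  proof (induction A)
    case empty
    thus ?case by (simp add: Q_def)
  next
    case (add z A)
    have z: "cmod (1 - z) * cmod (cis (2 * a) - z) \<le> (cmod (cis a - z))\<^sup>2"
      using add.prems off unit by (intro dist_endpoints_le_dist_midpoint_squared assms(1)) auto
    have ev: "cmod (poly (Q (add_mset z A)) x) = cmod (x - z) * cmod (poly (Q A) x)" for x
      by (simp add: Q_def norm_mult left_diff_distrib flip: norm_mult)
    show ?case
      using mult_mono[OF z add.IH] add.prems by (simp add: ev power_mult_distrib mult_ac)
  qed
  have p: "p = smult (lead_coeff p) (Q (proots p))"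
    unfolding Q_def by (rule complex_poly_decompose_multiset[symmetric])
  have ev: "cmod (poly p x) = cmod (lead_coeff p) * cmod (poly (Q (proots p)) x)" for x
    by (subst p) (simp add: norm_mult)
  have "(cmod (lead_coeff p))\<^sup>2 * (cmod (poly (Q (proots p)) 1) * cmod (poly (Q (proots p)) (cis (2 * a))))
    \<le> (cmod (lead_coeff p))\<^sup>2 * (cmod (poly (Q (proots p)) (cis a)))\<^sup>2"
    using \<open>p \<noteq> 0\<close> by (intro mult_left_mono Q) auto
  thus ?thesis
    unfolding ev by (simp add: power2_eq_square mult_ac)
qed

section \<open>The five-term polynomial on the unit circle\<close>

text \<open>The crude bound 9/4 suffices because \<open>2 * k - 1\<close> is at least 9 once
  \<open>k\<close> is at least 5.\<close>

lemma mult_sin_less: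
  fixes t :: real
  assumes "0 < t" "t < pi"
  shows "t * sin t < 9 / 4"
proof (cases "t < 9 / 4")
  case True
  have "t * sin t \<le> t" using assms by simp
  thus ?thesis using True by simp
next
  case False
  have "sin t \<le> pi - t"
    using sin_x_le_x[of "pi - t"] assms by simp
  hence "t * sin t \<le> t * (pi - t)"
    using assms by simp
  \<comment> \<open>The added product is nonnegative and turns the parabola
    \<open>t * (pi - t)\<close> into its value at 9/4.\<close>
  also have "\<dots> \<le> t * (pi - t) + (t - 9 / 4) * (t + 9 / 4 - pi)"
    using False pi_less_4 by (simp add: zero_le_mult_iff)
  also have "\<dots> = 9 / 4 * (pi - 9 / 4)" by (simp add: algebra_simps)
  also have "\<dots> < 9 / 4" using pi_approx by simp
  finally show ?thesis .
qed

definition S_poly :: "nat \<Rightarrow> int poly" where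
  "S_poly k = 1 - monom 1 1 + monom 1 k - monom 1 (2 * k - 1) + monom 1 (2 * k)"

lemma poly_S_poly:
  fixes z :: "'a :: comm_ring_1"
  shows "poly (map_poly of_int (S_poly k)) z = 1 - z + z ^ k - z ^ (2 * k - 1) + z ^ (2 * k)"
proof -
  have "map_poly of_int (S_poly k)
    = (1 - monom 1 1 + monom 1 k - monom 1 (2 * k - 1) + monom 1 (2 * k) :: 'a poly)"
    by (rule poly_eqI) (simp add: S_poly_def coeff_map_poly flip: monom_eq_1)
  thus ?thesis by (simp add: poly_monom)
qed

text \<open>The coefficients are palindromic. A Kronecker polynomial with this symmetry has all its
  roots on the unit circle.\<close>

lemma S_poly_inverse_root:
  fixes z :: "'a :: field"
  assumes "0 < k" "poly (map_poly of_int (S_poly k)) z = 0"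
  shows "poly (map_poly of_int (S_poly k)) (inverse z) = 0"
proof -
  obtain m where k: "k = Suc m" using assms(1) gr0_implies_Suc by blast
  have "z \<noteq> 0" using assms by (auto simp: poly_S_poly power_0_left)
  hence "z ^ (2 * k) * (1 - inverse z + inverse z ^ k - inverse z ^ (2 * k - 1) + inverse z ^ (2 * k))
    = 1 - z + z ^ k - z ^ (2 * k - 1) + z ^ (2 * k)"
    unfolding k by (simp add: field_simps mult_2 mult_2_right power_add)
  thus ?thesis using assms \<open>z \<noteq> 0\<close> by (simp add: poly_S_poly)
qed

text \<open>By the palindromic symmetry, dividing by \<open>cis (k * t)\<close> leaves a real cosine
  sum, which a product formula turns into sines.\<close>

lemma cmod_S_poly_cis:
  assumes "0 < k"
  shows "cmod (poly (map_poly of_int (S_poly k)) (cis t))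
    = \<bar>1 - 4 * (sin (real (2 * k - 1) * (t / 2)) * sin (t / 2))\<bar>"
proof -
  obtain m where k: "k = Suc m" using assms gr0_implies_Suc by blast
  define f where "f = 2 * cos (real k * t) - 2 * cos (real m * t) + 1"
  have cos_cis: "complex_of_real (2 * cos s) = cis s + cis (- s)" for s
    by (simp add: complex_eq_iff)
  have "cis (real k * t) * complex_of_real f = cis (real k * t) *
      (cis (real k * t) + cis (- (real k * t)) - (cis (real m * t) + cis (- (real m * t))) + 1)"
    unfolding f_def by (simp only: of_real_add of_real_diff cos_cis of_real_1)
  also have "\<dots> = poly (map_poly of_int (S_poly k)) (cis t)"
    by (simp add: poly_S_poly Complex.DeMoivre cis_mult k algebra_simps flip: cis_zero)
  finally have "cmod (poly (map_poly of_int (S_poly k)) (cis t)) = cmod (cis (real k * t) * complex_of_real f)"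
    by simp
  also have "\<dots> = \<bar>f\<bar>" by (simp add: norm_mult)
  also have "f = 1 - 4 * (sin (real (2 * k - 1) * (t / 2)) * sin (t / 2))"
  proof -
    have "real (2 * k - 1) * (t / 2) - t / 2 = real m * t" "real (2 * k - 1) * (t / 2) + t / 2 = real k * t"
      by (simp_all add: k field_simps)
    thus ?thesis by (simp add: f_def sin_times_sin diff_divide_distrib)
  qed
  finally show ?thesis .
qed

lemma not_kronecker_S_poly:
  assumes "5 \<le> k"
  shows "\<not> kronecker_poly (S_poly k)"
proof
  assume kr: "kronecker_poly (S_poly k)"
  define n where "n = real (2 * k - 1)"
  \<comment> \<open>Chosen so that \<open>sin (n * t / 2)\<close> vanishes at
    \<open>t = 2 * a\<close> and equals 1 at \<open>t = a\<close>.\<close>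
  define a where "a = pi / n"
  define p :: "complex poly" where "p = map_poly of_int (S_poly k)"
  have n: "9 \<le> n" using assms by (simp add: n_def)
  have na: "n * a = pi" and a: "0 < a" using n by (simp_all add: a_def)
  have ev: "cmod (poly p (cis t)) = \<bar>1 - 4 * (sin (n * (t / 2)) * sin (t / 2))\<bar>" for t
    using assms cmod_S_poly_cis[of k t] by (simp add: p_def n_def)
  have unit: "cmod z = 1" if "poly p z = 0" for z
  proof -
    have "cmod z \<le> 1" using kr that by (simp add: kronecker_poly_def p_def)
    moreover have "cmod (inverse z) \<le> 1"
      using kr S_poly_inverse_root[of k z] that assms by (simp add: kronecker_poly_def p_def)
    moreover have "z \<noteq> 0" using that assms by (auto simp: p_def poly_S_poly power_0_left)
    ultimately show ?thesis by (simp add: norm_inverse inverse_le_1_iff)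
  qed
  have off: "poly p (cis t) \<noteq> 0" if "0 < t" "t < 2 * a" for t
  proof -
    define s where "s = t / 2"
    have s: "0 < s" "n * s < pi"
      using that n na mult_strict_left_mono[of s a n] by (auto simp: s_def)
    have pos: "0 < n * s" using n s by simp
    \<comment> \<open>Multiplying by \<open>n\<close> and replacing \<open>sin s\<close> by
      \<open>s\<close> brings the product into the form covered by
      \<open>mult_sin_less\<close>.\<close>
    have "n * (sin (n * s) * sin s) \<le> n * (sin (n * s) * s)"
      using s n pos by (intro mult_left_mono sin_x_le_x sin_ge_zero) auto
    also have "\<dots> < 9 / 4"
      using mult_sin_less[OF pos s(2)] by (simp add: mult_ac)
    also have "\<dots> \<le> n * (1 / 4)" using n by simp
    finally have "sin (n * s) * sin s < 1 / 4"
      using n mult_less_cancel_left_pos[of n] by simp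
    thus ?thesis using ev[of t] by (auto simp: s_def)
  qed
  have "cmod (poly p 1) = 1" "cmod (poly p (cis (2 * a))) = 1"
    using ev[of 0] ev[of "2 * a"] na by simp_all
  moreover have "cmod (poly p (cis a)) < 1"
  proof -
    \<comment> \<open>At the midpoint the modulus is \<open>\<bar>1 - 4 * sin (a / 2)\<bar>\<close>,
      which is below 1 when the sine lies strictly between 0 and 1/2.\<close>
    have "a / 2 < 1 / 2"
      using n pi_less_4 by (simp add: a_def divide_less_eq)
    hence "0 < sin (a / 2)" "sin (a / 2) < 1 / 2"
      using a sin_x_le_x[of "a / 2"] pi_gt3 by (auto intro!: sin_gt_zero)
    moreover have "n * (a / 2) = pi / 2" using na by simp
    ultimately show ?thesis using ev[of a] by (simp add: abs_less_iff)
  qed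
  moreover have "cmod (poly p 1) * cmod (poly p (cis (2 * a))) \<le> (cmod (poly p (cis a)))\<^sup>2"
    using a unit off by (intro poly_endpoints_le_midpoint_squared)
  ultimately show False
    using power_strict_mono[of "cmod (poly p (cis a))" 1 2] by simp
qed

section \<open>The semigroup and its polynomial\<close>

lemma gaps_S_semigroup:
  assumes "2 \<le> k"
  shows "gaps (S_semigroup k) = insert (2 * k - 1) {1..<k}"
  using assms by (auto simp: gaps_def S_semigroup_def)

lemma numerical_semigroup_S_semigroup:
  assumes "2 \<le> k"
  shows "numerical_semigroup (S_semigroup k)"
proof -
  have "finite (- S_semigroup k)"
    using gaps_S_semigroup[OF assms] by (simp add: gaps_def)
  \<comment> \<open>Two nonzero elements add up to at least \<open>2 * k\<close>, beyond the hole at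
    \<open>2 * k - 1\<close>.\<close>
  thus ?thesis
    using assms by (auto simp: numerical_semigroup_def S_semigroup_def)
qed

lemma symmetric_semigroup_S_semigroup:
  assumes "2 \<le> k"
  shows "symmetric_semigroup (S_semigroup k)"
proof -
  have "Max (gaps (S_semigroup k)) = 2 * k - 1"
    using assms by (intro Max_eqI) (auto simp: gaps_S_semigroup)
  hence frob: "frobenius (S_semigroup k) = 2 * int k - 1"
    using assms by (auto simp: frobenius_def gaps_S_semigroup)
  have mem: "z \<in> int ` S_semigroup k \<longleftrightarrow> z = 0 \<or> int k \<le> z \<and> z \<noteq> 2 * int k - 1" for z
  proof -
    have "z \<in> int ` S_semigroup k \<longleftrightarrow> 0 \<le> z \<and> nat z \<in> S_semigroup k"
      by (metis image_iff int_nat_eq nat_int of_nat_0_le_iff)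
    thus ?thesis using assms by (auto simp: S_semigroup_def)
  qed
  \<comment> \<open>The reflection \<open>z\<close> to \<open>2 * k - 1 - z\<close> swaps 0 with the
    hole and the integers from \<open>k\<close> on with those below \<open>k\<close>.\<close>
  show ?thesis
    using assms unfolding symmetric_semigroup_def frob mem
    by (auto simp: numerical_semigroup_S_semigroup)
qed

text \<open>The gaps below \<open>k\<close> telescope to \<open>x^k - x\<close>; the isolated gap
  contributes \<open>x^(2k) - x^(2k-1)\<close>.\<close>

lemma semigroup_poly_S_semigroup:
  assumes "2 \<le> k"
  shows "semigroup_poly (S_semigroup k) = S_poly k"
proof -
  let ?x = "monom 1 1 :: int poly"
  have "(?x - 1) * (\<Sum>g\<in>{1..<k}. monom 1 g) = monom 1 k - ?x"
    using assms
    by (induction k rule: dec_induct)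
      (simp_all add: algebra_simps mult_monom numeral_2_eq_2)
  moreover have "?x * monom 1 (2 * k - 1) = monom 1 (2 * k)"
    using assms by (simp add: mult_monom)
  moreover have "2 * k - 1 \<notin> {1..<k}"
    by auto
  ultimately show ?thesis
    unfolding semigroup_poly_def gaps_S_semigroup[OF assms] S_poly_def
    by (simp add: algebra_simps)
qed

theorem theorem6p1:
  fixes k :: nat
  assumes "k \<ge> 5"
  shows "numerical_semigroup (S_semigroup k)
    \<and> symmetric_semigroup (S_semigroup k)
    \<and> \<not> cyclotomic_semigroup (S_semigroup k)
    \<and> semigroup_poly (S_semigroup k)
        = 1 - monom 1 1 + monom 1 k - monom 1 (2 * k - 1) + monom 1 (2 * k)
    \<and> \<not> kronecker_poly (1 - monom 1 1 + monom 1 k - monom 1 (2 * k - 1) + monom 1 (2 * k))"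
  using assms numerical_semigroup_S_semigroup[of k] symmetric_semigroup_S_semigroup[of k]
    semigroup_poly_S_semigroup[of k] not_kronecker_S_poly[of k]
  unfolding cyclotomic_semigroup_def S_poly_def[symmetric] by simp

end
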